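(* Let $0<\gamma\le1$, let $X$ be a quasi-Banach space and let $Y,\widetilde Y$ be $\gamma$-Banach spaces. Let $T:X\to Y$ be a bounded linear operator and let $\iota:Y\to\widetilde Y$ be a metric injection. Then for each $k\in\mathbb N$, $$e_k(\iota T)\le e_k(T)\le 2^{1/\gamma}e_k(\iota T)\qquad\text{and}\qquad f_k(T)=f_k(\iota T).$$
   Context: All vector spaces are real. For $\gamma\in(0,1]$, a $\gamma$-norm on a vector space $X$ is a function $\|\cdot|X\|:X\to[0,\infty)$ that vanishes only at $0$, is absolutely homogeneous, and satisfies $\|x+y|X\|^\gamma\le\|x|X\|^\gamma+\|y|X\|^\gamma$ for all $x,y\in X$. A quasi-norm is defined in the same way, with this last inequality replaced by $\|x+y|X\|\le C(\|x|X\|+\|y|X\|)$ for some constant $C\ge1$. A $\gamma$-Banach space (resp. quasi-Banach space) is a vector space that is complete with respect to a given $\gamma$-norm (resp. quasi-norm). $B_X$ denotes the closed unit ball of $X$. A metric injection $\iota:Y\to\widetilde Y$ is a continuous linear map with $\|\iota y|\widetilde Y\|=\|y|Y\|$ for all $y\in Y$. For a bounded linear operator $T:X\to Y$ and $k\in\mathbb N=\{1,2,\dots\}$: the $k$-th (outer) entropy number $e_k(T)$ is the infimum of all $\varepsilon>0$ such that $T(B_X)$ can be covered by $2^{k-1}$ balls $y+\varepsilon B_Y$ ($y\in Y$) in $Y$ of radius $\varepsilon$; the $k$-th inner entropy number $f_k(T)$ is the supremum of all $\varepsilon>0$ for which there are $x_1,\dots,x_{2^{k-1}+1}\in B_X$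 with $\|Tx_i-Tx_j|Y\|\ge2\varepsilon$ for all distinct $i,j\in\{1,\dots,2^{k-1}+1\}$ (the supremum of the empty set being $0$). *)

theory Defs
  imports "HOL-Analysis.Analysis"
begin

(* A vector space is a type of class real_vector; its (quasi-)norm is an explicit function,
   since quasi-norms are not instances of the class real_normed_vector. *)

definition gamma_norm :: "real \<Rightarrow> ('a::real_vector \<Rightarrow> real) \<Rightarrow> bool" where
  "gamma_norm \<gamma> N \<longleftrightarrow>
     (\<forall>x. 0 \<le> N x) \<and>
     (\<forall>x. N x = 0 \<longleftrightarrow> x = 0) \<and>
     (\<forall>c x. N (c *\<^sub>R x) = \<bar>c\<bar> * N x) \<and>
     (\<forall>x y. N (x + y) powr \<gamma> \<le> N x powr \<gamma> + N y powr \<gamma>)"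

definition quasi_norm :: "('a::real_vector \<Rightarrow> real) \<Rightarrow> bool" where
  "quasi_norm N \<longleftrightarrow>
     (\<forall>x. 0 \<le> N x) \<and>
     (\<forall>x. N x = 0 \<longleftrightarrow> x = 0) \<and>
     (\<forall>c x. N (c *\<^sub>R x) = \<bar>c\<bar> * N x) \<and>
     (\<exists>C\<ge>1. \<forall>x y. N (x + y) \<le> C * (N x + N y))"

definition complete_wrt :: "('a::real_vector \<Rightarrow> real) \<Rightarrow> bool" where
  "complete_wrt N \<longleftrightarrow>
     (\<forall>s :: nat \<Rightarrow> 'a.
        (\<forall>\<epsilon>>0. \<exists>M. \<forall>m\<ge>M. \<forall>n\<ge>M. N (s m - s n) < \<epsilon>) \<longrightarrow>
        (\<exists>l. (\<lambda>n. N (s n - l)) \<longlonglongrightarrow> 0))"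

definition gamma_Banach :: "real \<Rightarrow> ('a::real_vector \<Rightarrow> real) \<Rightarrow> bool" where
  "gamma_Banach \<gamma> N \<longleftrightarrow> gamma_norm \<gamma> N \<and> complete_wrt N"

definition quasi_Banach :: "('a::real_vector \<Rightarrow> real) \<Rightarrow> bool" where
  "quasi_Banach N \<longleftrightarrow> quasi_norm N \<and> complete_wrt N"

definition unit_ball :: "('a::real_vector \<Rightarrow> real) \<Rightarrow> 'a set" where
  "unit_ball N = {x. N x \<le> 1}"

definition bounded_operator ::
  "('a::real_vector \<Rightarrow> real) \<Rightarrow> ('b::real_vector \<Rightarrow> real) \<Rightarrow> ('a \<Rightarrow> 'b) \<Rightarrow> bool" where
  "bounded_operator NX NY T \<longleftrightarrow> linear T \<and> (\<exists>K. \<forall>x. NY (T x) \<le> K * NX x)"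

definition continuous_wrt ::
  "('a::real_vector \<Rightarrow> real) \<Rightarrow> ('b::real_vector \<Rightarrow> real) \<Rightarrow> ('a \<Rightarrow> 'b) \<Rightarrow> bool" where
  "continuous_wrt NX NY f \<longleftrightarrow>
     (\<forall>x. \<forall>\<epsilon>>0. \<exists>\<delta>>0. \<forall>x'. NX (x' - x) < \<delta> \<longrightarrow> NY (f x' - f x) < \<epsilon>)"

definition metric_injection ::
  "('a::real_vector \<Rightarrow> real) \<Rightarrow> ('b::real_vector \<Rightarrow> real) \<Rightarrow> ('a \<Rightarrow> 'b) \<Rightarrow> bool" where
  "metric_injection NY NZ \<iota> \<longleftrightarrow>
     linear \<iota> \<and> continuous_wrt NY NZ \<iota> \<and> (\<forall>y. NZ (\<iota> y) = NY y)"

(* For a bounded operator between quasi-normed spaces, the set under Inf is nonempty and bounded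
   below, and the set under Sup is bounded above, so the real-valued Inf and Sup are the genuine
   infimum and supremum. The Sup of the empty real set is unspecified in HOL, hence the
   case distinction in inner_entropy. *)

definition outer_entropy ::
  "('a::real_vector \<Rightarrow> real) \<Rightarrow> ('b::real_vector \<Rightarrow> real) \<Rightarrow> nat \<Rightarrow> ('a \<Rightarrow> 'b) \<Rightarrow> real" where
  "outer_entropy NX NY k T =
     Inf {\<epsilon>. \<epsilon> > 0 \<and>
       (\<exists>y :: nat \<Rightarrow> 'b.
          T ` unit_ball NX \<subseteq> (\<Union>i\<in>{1..2 ^ (k - 1)}. (\<lambda>z. y i + \<epsilon> *\<^sub>R z) ` unit_ball NY))}"

definition inner_entropy_radii ::
  "('a::real_vector \<Rightarrow> real) \<Rightarrow> ('b::real_vector \<Rightarrow> real) \<Rightarrow> nat \<Rightarrow> ('a \<Rightarrow> 'b) \<Rightarrow> real set" where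
  "inner_entropy_radii NX NY k T =
     {\<epsilon>. \<epsilon> > 0 \<and>
       (\<exists>x :: nat \<Rightarrow> 'a.
          (\<forall>i\<in>{1..2 ^ (k - 1) + 1}. x i \<in> unit_ball NX) \<and>
          (\<forall>i\<in>{1..2 ^ (k - 1) + 1}. \<forall>j\<in>{1..2 ^ (k - 1) + 1}.
             i \<noteq> j \<longrightarrow> NY (T (x i) - T (x j)) \<ge> 2 * \<epsilon>))}"

definition inner_entropy ::
  "('a::real_vector \<Rightarrow> real) \<Rightarrow> ('b::real_vector \<Rightarrow> real) \<Rightarrow> nat \<Rightarrow> ('a \<Rightarrow> 'b) \<Rightarrow> real" where
  "inner_entropy NX NY k T =
     (if inner_entropy_radii NX NY k T = {} then 0 else Sup (inner_entropy_radii NX NY k T))"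

end

theory Submission
  imports Defs
begin

text \<open>Both entropy numbers depend only on distances, and a linear metric injection preserves
  distances of points of Y. Hence the inner numbers agree outright, and pushing centres forward
  along \<open>\<iota>\<close> turns each cover in the small space into one in the large space with
  the same radius. Conversely, centres in the large space may lie outside the range of
  \<open>\<iota>\<close>; they are replaced by points of the image of the unit ball lying in the
  same balls. By \<open>gamma_norm_diff_le\<close> this costs the factor
  \<open>2 powr (1 / \<gamma>)\<close>. To pass to infima, covers are phrased by distances in
  \<open>cover_radii\<close>, and the resulting sets of radii are compared.\<close>

definition cover_radii ::
  "('a::real_vector \<Rightarrow> real) \<Rightarrow> ('b::real_vector \<Rightarrow> real) \<Rightarrow> nat \<Rightarrow> ('a \<Rightarrow> 'b) \<Rightarrow> real set" where
  "cover_radii NX NY k T =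
     {\<epsilon>. \<epsilon> > 0 \<and>
       (\<exists>y :: nat \<Rightarrow> 'b. \<forall>x. NX x \<le> 1 \<longrightarrow> (\<exists>i\<in>{1..2 ^ (k - 1)}. NY (T x - y i) \<le> \<epsilon>))}"

lemma gamma_norm_minus_commute:
  assumes "gamma_norm \<gamma> N"
  shows "N (x - y) = N (y - x)"
proof -
  have "N ((-1) *\<^sub>R (y - x)) = \<bar>-1\<bar> * N (y - x)"
    using assms unfolding gamma_norm_def by blast
  then show ?thesis by simp
qed

text \<open>This is the source of the constant: between two points of one ball the
  \<open>\<gamma>\<close>-th powers of the distances to the centre add up to at most twice
  \<open>\<epsilon> powr \<gamma>\<close>, and taking the \<open>\<gamma>\<close>-th root turns 2
  into \<open>2 powr (1 / \<gamma>)\<close>.\<close>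

lemma gamma_norm_diff_le:
  assumes N: "gamma_norm \<gamma> N" and "0 < \<gamma>" and "N (x - z) \<le> \<epsilon>" and "N (y - z) \<le> \<epsilon>"
  shows "N (x - y) \<le> 2 powr (1 / \<gamma>) * \<epsilon>"
proof -
  have nn: "0 \<le> N v" for v
    using N by (simp add: gamma_norm_def)
  have "0 \<le> \<epsilon>" using assms(3) nn[of "x - z"] by linarith
  have "N ((x - z) + (z - y)) powr \<gamma> \<le> N (x - z) powr \<gamma> + N (z - y) powr \<gamma>"
    using N unfolding gamma_norm_def by blast
  also have "\<dots> \<le> \<epsilon> powr \<gamma> + \<epsilon> powr \<gamma>"
    using assms nn gamma_norm_minus_commute[OF N, of z y]
    by (intro add_mono powr_mono2) auto
  also have "\<dots> = (2 powr (1 / \<gamma>) * \<epsilon>) powr \<gamma>"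
    using \<open>0 < \<gamma>\<close> \<open>0 \<le> \<epsilon>\<close> by (simp add: powr_mult powr_powr)
  finally have "N (x - y) powr \<gamma> \<le> (2 powr (1 / \<gamma>) * \<epsilon>) powr \<gamma>"
    by simp
  then show ?thesis
    using \<open>0 < \<gamma>\<close> \<open>0 \<le> \<epsilon>\<close> nn by (meson linorder_not_le mult_nonneg_nonneg powr_ge_zero powr_less_mono2)
qed

text \<open>By homogeneity, dividing \<open>v - y\<close> by the positive \<open>\<epsilon>\<close>
  lands in the unit ball exactly when the distance is at most \<open>\<epsilon>\<close>.\<close>

lemma mem_scaled_unit_ball_iff:
  assumes "gamma_norm \<gamma> N" and "\<epsilon> > 0"
  shows "v \<in> (\<lambda>z. y + \<epsilon> *\<^sub>R z) ` unit_ball N \<longleftrightarrow> N (v - y) \<le> \<epsilon>"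
proof
  have hom: "N (c *\<^sub>R x) = \<bar>c\<bar> * N x" for c x
    using assms unfolding gamma_norm_def by blast
  show "N (v - y) \<le> \<epsilon>" if "v \<in> (\<lambda>z. y + \<epsilon> *\<^sub>R z) ` unit_ball N"
    using that assms(2) by (auto simp: unit_ball_def hom)
  show "v \<in> (\<lambda>z. y + \<epsilon> *\<^sub>R z) ` unit_ball N" if "N (v - y) \<le> \<epsilon>"
    using that assms(2)
    by (intro image_eqI[of _ _ "(1 / \<epsilon>) *\<^sub>R (v - y)"]) (auto simp: unit_ball_def hom)
qed

lemma outer_entropy_eq_Inf_cover_radii:
  fixes NX :: "'a::real_vector \<Rightarrow> real" and NY :: "'b::real_vector \<Rightarrow> real"
  assumes "gamma_norm \<gamma> NY"
  shows "outer_entropy NX NY k T = Inf (cover_radii NX NY k T)"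
proof -
  have "(T ` unit_ball NX \<subseteq> (\<Union>i\<in>{1..2 ^ (k - 1)}. (\<lambda>z. y i + \<epsilon> *\<^sub>R z) ` unit_ball NY))
      \<longleftrightarrow> (\<forall>x. NX x \<le> 1 \<longrightarrow> (\<exists>i\<in>{1..2 ^ (k - 1)}. NY (T x - y i) \<le> \<epsilon>))"
    if "\<epsilon> > 0" for \<epsilon> and y :: "nat \<Rightarrow> 'b"
    unfolding subset_iff UN_iff mem_scaled_unit_ball_iff[OF assms that]
    by (auto simp: unit_ball_def)
  then show ?thesis
    unfolding outer_entropy_def cover_radii_def by (intro arg_cong[where f = Inf] Collect_cong) blast
qed

lemma bdd_below_cover_radii: "bdd_below (cover_radii NX NY k T)"
  by (rule bdd_belowI[of _ 0]) (auto simp: cover_radii_def)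

text \<open>Boundedness lets a single ball around 0 cover the image. Comparing real infima requires
  nonempty sets.\<close>

lemma cover_radii_nonempty:
  assumes "bounded_operator NX NY T" and "\<And>x. 0 \<le> NX x"
  shows "cover_radii NX NY k T \<noteq> {}"
proof -
  obtain K where K: "\<And>x. NY (T x) \<le> K * NX x"
    using assms(1) by (auto simp: bounded_operator_def)
  \<comment> \<open>The bound \<open>K\<close> may be zero or negative, whereas a radius must be
    positive; hence the maximum with 1.\<close>
  have "NY (T x) \<le> max K 1" if "NX x \<le> 1" for x
  proof -
    have "K * NX x \<le> max K 1 * NX x"
      using assms(2) by (intro mult_right_mono) auto
    also have "\<dots> \<le> max K 1"
      using that by (simp add: mult_left_le)
    finally show ?thesis using K[of x] by linarith
  qed
  then have "max K 1 \<in> cover_radii NX NY k T"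
    unfolding cover_radii_def by (auto intro!: exI[of _ "\<lambda>_. 0"] bexI[of _ 1])
  then show ?thesis by blast
qed

lemma metric_injection_diff:
  assumes "metric_injection NY NZ \<iota>"
  shows "NZ (\<iota> x - \<iota> y) = NY (x - y)"
  using assms unfolding metric_injection_def by (metis linear_diff)

lemma cover_radii_comp_subset:
  fixes NX :: "'a::real_vector \<Rightarrow> real" and NY :: "'b::real_vector \<Rightarrow> real"
    and NZ :: "'c::real_vector \<Rightarrow> real"
  assumes "metric_injection NY NZ \<iota>"
  shows "cover_radii NX NY k T \<subseteq> cover_radii NX NZ k (\<iota> \<circ> T)"
proof
  fix \<epsilon> assume "\<epsilon> \<in> cover_radii NX NY k T"
  then obtain y :: "nat \<Rightarrow> 'b" where "\<epsilon> > 0"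
    and y: "\<And>x. NX x \<le> 1 \<Longrightarrow> \<exists>i\<in>{1..2 ^ (k - 1)}. NY (T x - y i) \<le> \<epsilon>"
    by (auto simp: cover_radii_def)
  then show "\<epsilon> \<in> cover_radii NX NZ k (\<iota> \<circ> T)"
    by (auto simp: cover_radii_def metric_injection_diff[OF assms] intro!: exI[of _ "\<iota> \<circ> y"])
qed

text \<open>The centres of a cover in the larger space need not lie in the range of \<open>\<iota>\<close>. Re-centring
  every ball that meets the image of the unit ball at a point of that image moves the cover into
  the smaller space; the \<open>\<gamma>\<close>-triangle inequality bounds the loss in the radius.\<close>

lemma cover_radii_comp_scale:
  fixes NX :: "'a::real_vector \<Rightarrow> real" and NY :: "'b::real_vector \<Rightarrow> real"
    and NZ :: "'c::real_vector \<Rightarrow> real"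
  assumes "0 < \<gamma>" and "gamma_norm \<gamma> NZ" and \<iota>: "metric_injection NY NZ \<iota>"
    and "\<epsilon> \<in> cover_radii NX NZ k (\<iota> \<circ> T)"
  shows "2 powr (1 / \<gamma>) * \<epsilon> \<in> cover_radii NX NY k T"
proof -
  obtain z :: "nat \<Rightarrow> 'c" where "\<epsilon> > 0"
    and z: "\<And>x. NX x \<le> 1 \<Longrightarrow> \<exists>i\<in>{1..2 ^ (k - 1)}. NZ (\<iota> (T x) - z i) \<le> \<epsilon>"
    using assms(4) by (auto simp: cover_radii_def)
  \<comment> \<open>If ball \<open>i\<close> misses the image, \<open>c i\<close> is an arbitrary
    value; this is harmless, since only indices whose ball contains some
    \<open>\<iota> (T x)\<close> are used below.\<close>
  define c where "c i = (SOME x. NX x \<le> 1 \<and> NZ (\<iota> (T x) - z i) \<le> \<epsilon>)" for i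
  have "\<exists>i\<in>{1..2 ^ (k - 1)}. NY (T x - T (c i)) \<le> 2 powr (1 / \<gamma>) * \<epsilon>" if "NX x \<le> 1" for x
  proof -
    obtain i where i: "i \<in> {1..2 ^ (k - 1)}" and xi: "NZ (\<iota> (T x) - z i) \<le> \<epsilon>"
      using z \<open>NX x \<le> 1\<close> by blast
    have "NX (c i) \<le> 1 \<and> NZ (\<iota> (T (c i)) - z i) \<le> \<epsilon>"
      unfolding c_def by (rule someI[of _ x]) (use that xi in blast)
    \<comment> \<open>The estimate is made in the larger space, where the common centre
      \<open>z i\<close> lives; its result involves only points of the range of
      \<open>\<iota>\<close> and so pulls back to \<open>NY\<close>.\<close>
    then have "NZ (\<iota> (T x) - \<iota> (T (c i))) \<le> 2 powr (1 / \<gamma>) * \<epsilon>"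
      using gamma_norm_diff_le[OF assms(2,1) xi] by blast
    then show ?thesis
      using i by (auto simp: metric_injection_diff[OF \<iota>])
  qed
  then show ?thesis
    using \<open>\<epsilon> > 0\<close> by (auto simp: cover_radii_def intro!: exI[of _ "\<lambda>i. T (c i)"])
qed

text \<open>Only mutual distances of image points enter, so the two sets of radii coincide, and the
  empty case agrees as well.\<close>

lemma inner_entropy_comp_metric_injection:
  assumes "metric_injection NY NZ \<iota>"
  shows "inner_entropy NX NZ k (\<iota> \<circ> T) = inner_entropy NX NY k T"
  unfolding inner_entropy_def inner_entropy_radii_def o_apply metric_injection_diff[OF assms] ..

theorem proposition15:
  fixes \<gamma> :: real
    and NX :: "'x::real_vector \<Rightarrow> real"
    and NY :: "'y::real_vector \<Rightarrow> real"
    and NZ :: "'z::real_vector \<Rightarrow> real"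
    and T :: "'x \<Rightarrow> 'y"
    and \<iota> :: "'y \<Rightarrow> 'z"
    and k :: nat
  assumes "0 < \<gamma>" and "\<gamma> \<le> 1"
    and "quasi_Banach NX"
    and "gamma_Banach \<gamma> NY"
    and "gamma_Banach \<gamma> NZ"
    and "bounded_operator NX NY T"
    and "metric_injection NY NZ \<iota>"
    and "k \<ge> 1"
  shows "outer_entropy NX NZ k (\<iota> \<circ> T) \<le> outer_entropy NX NY k T
       \<and> outer_entropy NX NY k T \<le> 2 powr (1 / \<gamma>) * outer_entropy NX NZ k (\<iota> \<circ> T)
       \<and> inner_entropy NX NY k T = inner_entropy NX NZ k (\<iota> \<circ> T)"
proof (intro conjI)
  have NY: "gamma_norm \<gamma> NY" and NZ: "gamma_norm \<gamma> NZ"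
    using assms(4,5) by (auto simp: gamma_Banach_def)
  have "\<And>x. 0 \<le> NX x"
    using assms(3) by (simp add: quasi_Banach_def quasi_norm_def)
  then have ne: "cover_radii NX NY k T \<noteq> {}"
    using cover_radii_nonempty assms(6) by blast
  note sub = cover_radii_comp_subset[OF assms(7), of NX k T]
  show "outer_entropy NX NZ k (\<iota> \<circ> T) \<le> outer_entropy NX NY k T"
    unfolding outer_entropy_eq_Inf_cover_radii[OF NY] outer_entropy_eq_Inf_cover_radii[OF NZ]
    by (rule cInf_superset_mono[OF ne bdd_below_cover_radii sub])
  \<comment> \<open>With the constant moved to the left, the claim says that a fixed number is a
    lower bound of all radii for \<open>\<iota> \<circ> T\<close>; these exist because the inclusion
    \<open>sub\<close> starts from a nonempty set.\<close>
  have "Inf (cover_radii NX NY k T) / 2 powr (1 / \<gamma>) \<le> Inf (cover_radii NX NZ k (\<iota> \<circ> T))"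
  proof (rule cInf_greatest)
    fix \<epsilon> assume "\<epsilon> \<in> cover_radii NX NZ k (\<iota> \<circ> T)"
    then have "Inf (cover_radii NX NY k T) \<le> 2 powr (1 / \<gamma>) * \<epsilon>"
      by (intro cInf_lower bdd_below_cover_radii cover_radii_comp_scale[OF assms(1) NZ assms(7)])
    then show "Inf (cover_radii NX NY k T) / 2 powr (1 / \<gamma>) \<le> \<epsilon>"
      by (simp add: field_simps)
  qed (use ne sub in blast)
  then show "outer_entropy NX NY k T \<le> 2 powr (1 / \<gamma>) * outer_entropy NX NZ k (\<iota> \<circ> T)"
    unfolding outer_entropy_eq_Inf_cover_radii[OF NY] outer_entropy_eq_Inf_cover_radii[OF NZ]
    by (simp add: field_simps)
  show "inner_entropy NX NY k T = inner_entropy NX NZ k (\<iota> \<circ> T)"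
    by (rule inner_entropy_comp_metric_injection[OF assms(7), symmetric])
qed

end
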